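(* Let $\Gamma$ be a countable graph. Then there exist $2^{\aleph_0}$ pairwise non-isomorphic strongly algebraically closed bipartite graphs whose automorphism group is isomorphic to $\operatorname{Aut}\Gamma$.
   Context: A graph is a pair $(V,E)$ with $E$ an irreflexive symmetric binary relation on the non-empty set $V$. A bipartite graph is a relational structure $(V,E,P)$ where $E$ is an irreflexive symmetric binary relation on $V$, $P=(V_0\times V_0)\cup(V_1\times V_1)$ for some partition $V=V_0\,\dot\cup\, V_1$, and $(u,v)\in E$ implies $(u,v)\notin P$. A homomorphism of bipartite graphs $(V,E,P)\to(W,F,Q)$ is a map $f:V\to W$ with $(uf,vf)\in F$ whenever $(u,v)\in E$ and $(uf,vf)\in Q$ whenever $(u,v)\in P$; an isomorphism/automorphism is a bijection $f$ such that both $f$ and $f^{-1}$ are homomorphisms (automorphisms may interchange the two parts). A bipartite graph is strongly algebraically closed if for every finite set $A$ of vertices which are pairwise $P$-related (i.e. all in the same part) there exist infinitely many vertices adjacent (via $E$) to every vertex of $A$. *)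

theory Defs
  imports "HOL-Algebra.Bij" "HOL-Library.Equipollence" "HOL-Library.Countable_Set"
begin

record 'a ugraph =
  verts :: "'a set"
  edges :: "'a rel"

definition undirected_graph :: "'a ugraph \<Rightarrow> bool" where
  "undirected_graph G \<longleftrightarrow>
     verts G \<noteq> {} \<and> edges G \<subseteq> verts G \<times> verts G \<and> irrefl (edges G) \<and> sym (edges G)"

definition graph_hom :: "'a ugraph \<Rightarrow> 'b ugraph \<Rightarrow> ('a \<Rightarrow> 'b) \<Rightarrow> bool" where
  "graph_hom G H f \<longleftrightarrow>
     f \<in> verts G \<rightarrow> verts H \<and> (\<forall>u v. (u, v) \<in> edges G \<longrightarrow> (f u, f v) \<in> edges H)"

definition graph_iso :: "'a ugraph \<Rightarrow> 'b ugraph \<Rightarrow> ('a \<Rightarrow> 'b) \<Rightarrow> bool" where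
  "graph_iso G H f \<longleftrightarrow>
     bij_betw f (verts G) (verts H) \<and> graph_hom G H f \<and> graph_hom H G (inv_into (verts G) f)"

text \<open>
  Composition in \<^const>\<open>BijGroup\<close> is that of left actions.  With maps written on the right one
  obtains the opposite group, which is isomorphic via inversion.
\<close>

definition graph_Aut :: "'a ugraph \<Rightarrow> ('a \<Rightarrow> 'a) monoid" where
  "graph_Aut G = (BijGroup (verts G)) \<lparr>carrier := {f \<in> Bij (verts G). graph_iso G G f}\<rparr>"

text \<open>The relation \<open>P\<close> of a bipartite graph \<open>(V, E, P)\<close> is the field \<open>same_part\<close>.\<close>

record 'a bigraph =
  bverts :: "'a set"
  bedges :: "'a rel"
  same_part :: "'a rel"

definition bipartite_graph :: "'a bigraph \<Rightarrow> bool" where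
  "bipartite_graph B \<longleftrightarrow>
     bedges B \<subseteq> bverts B \<times> bverts B \<and> irrefl (bedges B) \<and> sym (bedges B) \<and>
     (\<exists>V0 V1. V0 \<union> V1 = bverts B \<and> V0 \<inter> V1 = {} \<and> same_part B = V0 \<times> V0 \<union> V1 \<times> V1) \<and>
     (\<forall>u v. (u, v) \<in> bedges B \<longrightarrow> (u, v) \<notin> same_part B)"

definition bigraph_hom :: "'a bigraph \<Rightarrow> 'b bigraph \<Rightarrow> ('a \<Rightarrow> 'b) \<Rightarrow> bool" where
  "bigraph_hom B C f \<longleftrightarrow>
     f \<in> bverts B \<rightarrow> bverts C \<and>
     (\<forall>u v. (u, v) \<in> bedges B \<longrightarrow> (f u, f v) \<in> bedges C) \<and>
     (\<forall>u v. (u, v) \<in> same_part B \<longrightarrow> (f u, f v) \<in> same_part C)"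

definition bigraph_iso :: "'a bigraph \<Rightarrow> 'b bigraph \<Rightarrow> ('a \<Rightarrow> 'b) \<Rightarrow> bool" where
  "bigraph_iso B C f \<longleftrightarrow>
     bij_betw f (bverts B) (bverts C) \<and> bigraph_hom B C f \<and>
     bigraph_hom C B (inv_into (bverts B) f)"

definition bigraph_isomorphic :: "'a bigraph \<Rightarrow> 'b bigraph \<Rightarrow> bool" where
  "bigraph_isomorphic B C \<longleftrightarrow> (\<exists>f. bigraph_iso B C f)"

definition bigraph_Aut :: "'a bigraph \<Rightarrow> ('a \<Rightarrow> 'a) monoid" where
  "bigraph_Aut B = (BijGroup (bverts B)) \<lparr>carrier := {f \<in> Bij (bverts B). bigraph_iso B B f}\<rparr>"

definition strongly_algebraically_closed :: "'a bigraph \<Rightarrow> bool" where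
  "strongly_algebraically_closed B \<longleftrightarrow>
     (\<forall>A. finite A \<and> A \<subseteq> bverts B \<and> (\<forall>u\<in>A. \<forall>v\<in>A. (u, v) \<in> same_part B) \<longrightarrow>
        infinite {w \<in> bverts B. \<forall>a\<in>A. (a, w) \<in> bedges B})"

end

theory Submission
  imports Defs
begin

text \<open>
  For \<open>S \<subseteq> \<nat>\<close> we build a bipartite graph and take its bipartite complement, so that strong algebraic
  closure says that finitely many vertices of one part have infinitely many common non-neighbours.
  The graph is the barycentric subdivision of \<open>\<Gamma>\<close> together with a ray \<open>r\<^sub>0, r\<^sub>1, \<dots>\<close>; every vertex
  of \<open>\<Gamma>\<close> is joined to those \<open>r\<^sub>k\<close> for which \<open>k\<close> lies in an infinite set \<open>D\<^sub>S\<close> of odd numbers.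
  The vertex \<open>r\<^sub>0\<close> is the only leaf, and the vertices of \<open>\<Gamma>\<close> have infinite degree while \<open>r\<^sub>k\<close> has
  finite degree for even \<open>k\<close>; hence every isomorphism between two of these graphs fixes the ray
  pointwise.  Therefore \<open>D\<^sub>S\<close>, and with it \<open>S\<close>, is an isomorphism invariant, and automorphisms are
  precisely those induced by automorphisms of \<open>\<Gamma>\<close>.
\<close>

section \<open>Isomorphisms as relation-preserving bijections, and the automorphism groups\<close>

text \<open>That the inverse is a homomorphism amounts to \<open>f\<close> reflecting edges. Since
  edges join only vertices, quantifiers bounded by the vertex set suffice.\<close>

lemma graph_iso_iff:
  assumes "edges G \<subseteq> verts G \<times> verts G" "edges H \<subseteq> verts H \<times> verts H"
  shows "graph_iso G H f \<longleftrightarrow> bij_betw f (verts G) (verts H) \<and>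
    (\<forall>u\<in>verts G. \<forall>v\<in>verts G. (u, v) \<in> edges G \<longleftrightarrow> (f u, f v) \<in> edges H)"
proof (cases "bij_betw f (verts G) (verts H)")
  case True
  let ?g = "inv_into (verts G) f"
  have g: "?g ` verts H = verts G" "\<And>y. y \<in> verts H \<Longrightarrow> f (?g y) = y" "\<And>x. x \<in> verts G \<Longrightarrow> ?g (f x) = x"
    using True bij_betw_inv_into[OF True]
    by (auto simp: bij_betw_imp_surj_on bij_betw_inv_into_right bij_betw_inv_into_left)
  have fv: "f ` verts G = verts H" using True by (simp add: bij_betw_imp_surj_on)
  have "graph_hom G H f \<and> graph_hom H G ?g \<longleftrightarrow>
      (\<forall>u\<in>verts G. \<forall>v\<in>verts G. (u, v) \<in> edges G \<longleftrightarrow> (f u, f v) \<in> edges H)"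
    (is "?L \<longleftrightarrow> ?R")
  proof
    assume ?L
    then show ?R using g(3) unfolding graph_hom_def by metis
  next
    assume R: ?R
    have "(?g u, ?g v) \<in> edges G" if "(u, v) \<in> edges H" for u v
    proof -
      have "u \<in> verts H" "v \<in> verts H" using that assms(2) by auto
      then show ?thesis using that R g(1,2) by (metis image_eqI)
    qed
    then show ?L using R g(1) fv assms(1) unfolding graph_hom_def by blast
  qed
  with True show ?thesis by (simp add: graph_iso_def)
qed (simp add: graph_iso_def)

text \<open>A bipartite graph is split into two structures on one vertex set, one for each relation.
  \<open>graph_iso_iff\<close> asks for neither irreflexivity nor symmetry, so it applies to
  \<open>same_part\<close> as well.\<close>

lemma bigraph_iso_iff:
  assumes "bipartite_graph B" "bipartite_graph C"
  shows "bigraph_iso B C f \<longleftrightarrow> bij_betw f (bverts B) (bverts C) \<and>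
    (\<forall>u\<in>bverts B. \<forall>v\<in>bverts B. ((u, v) \<in> bedges B \<longleftrightarrow> (f u, f v) \<in> bedges C) \<and>
      ((u, v) \<in> same_part B \<longleftrightarrow> (f u, f v) \<in> same_part C))"
proof -
  define GB HB where "GB = \<lparr>verts = bverts B, edges = bedges B\<rparr>"
    and "HB = \<lparr>verts = bverts B, edges = same_part B\<rparr>"
  define GC HC where "GC = \<lparr>verts = bverts C, edges = bedges C\<rparr>"
    and "HC = \<lparr>verts = bverts C, edges = same_part C\<rparr>"
  have "bigraph_iso B C f \<longleftrightarrow> graph_iso GB GC f \<and> graph_iso HB HC f"
    by (auto simp: bigraph_iso_def bigraph_hom_def graph_iso_def graph_hom_def
        GB_def GC_def HB_def HC_def)
  moreover have "edges GB \<subseteq> verts GB \<times> verts GB" "edges HB \<subseteq> verts HB \<times> verts HB"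
    "edges GC \<subseteq> verts GC \<times> verts GC" "edges HC \<subseteq> verts HC \<times> verts HC"
    using assms by (auto simp: GB_def GC_def HB_def HC_def bipartite_graph_def)
  ultimately show ?thesis
    by (auto simp: graph_iso_iff GB_def GC_def HB_def HC_def)
qed

lemma graph_Aut_carrier:
  assumes "undirected_graph G"
  shows "f \<in> carrier (graph_Aut G) \<longleftrightarrow> f \<in> Bij (verts G) \<and>
    (\<forall>u\<in>verts G. \<forall>v\<in>verts G. (u, v) \<in> edges G \<longleftrightarrow> (f u, f v) \<in> edges G)"
  using assms by (auto simp: graph_Aut_def graph_iso_iff undirected_graph_def Bij_def)

lemma bigraph_Aut_mult:
  assumes "f \<in> carrier (bigraph_Aut B)" "g \<in> carrier (bigraph_Aut B)"
  shows "f \<otimes>\<^bsub>bigraph_Aut B\<^esub> g = compose (bverts B) f g"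
  using assms by (simp add: bigraph_Aut_def BijGroup_def)

lemma graph_Aut_mult:
  assumes "f \<in> carrier (graph_Aut G)" "g \<in> carrier (graph_Aut G)"
  shows "f \<otimes>\<^bsub>graph_Aut G\<^esub> g = compose (verts G) f g"
  using assms by (simp add: graph_Aut_def BijGroup_def)

lemma graph_Aut_closed:
  assumes "f \<in> carrier (graph_Aut G)" "x \<in> verts G"
  shows "f x \<in> verts G"
  using assms Bij_imp_funcset[of f "verts G"] by (auto simp: graph_Aut_def)

lemma bigraph_Aut_closed:
  assumes "f \<in> carrier (bigraph_Aut B)" "x \<in> bverts B"
  shows "f x \<in> bverts B"
  using assms Bij_imp_funcset[of f "bverts B"] by (auto simp: bigraph_Aut_def)

lemma bigraph_Aut_extensional:
  assumes "f \<in> carrier (bigraph_Aut B)"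
  shows "f \<in> extensional (bverts B)"
  using assms by (simp add: bigraph_Aut_def Bij_def)

text \<open>Symmetry of \<cong> requires a group on the left; this allows reversing the isomorphism
  from \<open>graph_Aut\<close> at the end.\<close>

lemma graph_Aut_group:
  assumes G: "undirected_graph G"
  shows "group (graph_Aut G)"
proof -
  have "subgroup (carrier (graph_Aut G)) (BijGroup (verts G))"
  proof (rule group.subgroupI[OF group_BijGroup])
    show "carrier (graph_Aut G) \<subseteq> carrier (BijGroup (verts G))"
      by (auto simp: graph_Aut_def BijGroup_def)
    have "(\<lambda>x\<in>verts G. x) \<in> carrier (graph_Aut G)"
      by (simp add: graph_Aut_carrier[OF G] id_Bij)
    then show "carrier (graph_Aut G) \<noteq> {}" by blast
  next
    fix f assume f: "f \<in> carrier (graph_Aut G)"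
    then have fb: "f \<in> Bij (verts G)" by (simp add: graph_Aut_carrier[OF G])
    then have bij: "bij_betw f (verts G) (verts G)" by (simp add: Bij_def)
    let ?g = "\<lambda>x\<in>verts G. inv_into (verts G) f x"
    have "inv\<^bsub>BijGroup (verts G)\<^esub> f = ?g" by (rule inv_BijGroup[OF fb])
    moreover have "?g \<in> carrier (graph_Aut G)"
      unfolding graph_Aut_carrier[OF G]
    proof (intro conjI ballI)
      show "?g \<in> Bij (verts G)" by (rule restrict_inv_into_Bij[OF fb])
      fix u v assume uv: "u \<in> verts G" "v \<in> verts G"
      then have "?g u \<in> verts G" "?g v \<in> verts G" "f (?g u) = u" "f (?g v) = v"
        using bij by (auto simp: bij_betw_inv_into_right bij_betw_imp_surj_on inv_into_into)
      then show "(u, v) \<in> edges G \<longleftrightarrow> (?g u, ?g v) \<in> edges G"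
        using f unfolding graph_Aut_carrier[OF G] by metis
    qed
    ultimately show "inv\<^bsub>BijGroup (verts G)\<^esub> f \<in> carrier (graph_Aut G)" by simp
  next
    fix f g assume fg: "f \<in> carrier (graph_Aut G)" "g \<in> carrier (graph_Aut G)"
    then have "f \<otimes>\<^bsub>BijGroup (verts G)\<^esub> g = compose (verts G) f g"
      by (simp add: graph_Aut_def BijGroup_def)
    moreover have "compose (verts G) f g \<in> carrier (graph_Aut G)"
      unfolding graph_Aut_carrier[OF G]
    proof (intro conjI ballI)
      show "compose (verts G) f g \<in> Bij (verts G)"
        using fg by (simp add: graph_Aut_carrier[OF G] compose_Bij)
      fix u v assume uv: "u \<in> verts G" "v \<in> verts G"
      with fg show "(u, v) \<in> edges G \<longleftrightarrow> (compose (verts G) f g u, compose (verts G) f g v) \<in> edges G"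
        using graph_Aut_closed[OF fg(2)] unfolding graph_Aut_carrier[OF G]
        by (metis compose_eq)
    qed
    ultimately show "f \<otimes>\<^bsub>BijGroup (verts G)\<^esub> g \<in> carrier (graph_Aut G)" by simp
  qed
  then have "group (BijGroup (verts G) \<lparr>carrier := carrier (graph_Aut G)\<rparr>)"
    by (rule group.subgroup_imp_group[OF group_BijGroup, rotated])
  then show ?thesis by (simp add: graph_Aut_def)
qed

lemma bigraph_iso_sym:
  assumes bip: "bipartite_graph B" "bipartite_graph C" and f: "bigraph_iso B C f"
  shows "bigraph_iso C B (inv_into (bverts B) f)"
proof -
  let ?g = "inv_into (bverts B) f"
  have bij: "bij_betw f (bverts B) (bverts C)" using f by (simp add: bigraph_iso_def)
  then have g: "?g y \<in> bverts B" "f (?g y) = y" if "y \<in> bverts C" for y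
    using that by (auto simp: bij_betw_inv_into_right bij_betw_imp_surj_on inv_into_into)
  show ?thesis
    using f g bij_betw_inv_into[OF bij] unfolding bigraph_iso_iff[OF bip] bigraph_iso_iff[OF bip(2,1)]
    by metis
qed

lemma bigraph_iso_trans:
  assumes "bipartite_graph A" "bipartite_graph B" "bipartite_graph C"
    and "bigraph_iso A B f" "bigraph_iso B C g"
  shows "bigraph_iso A C (g \<circ> f)"
proof -
  have bij: "bij_betw f (bverts A) (bverts B)" "bij_betw g (bverts B) (bverts C)"
    using assms(4,5) by (auto simp: bigraph_iso_def)
  have "f x \<in> bverts B" if "x \<in> bverts A" for x
    using bij(1) that by (rule bij_betw_apply)
  then show ?thesis
    using assms(4,5) bij_betw_trans[OF bij]
    by (simp add: bigraph_iso_iff assms(1-3))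
qed

text \<open>Conjugation by \<open>h\<close>, restricted to the vertex set because members of
  \<open>Bij\<close> are extensional.\<close>

lemma bigraph_iso_conj:
  assumes bip: "bipartite_graph B" "bipartite_graph C" and h: "bigraph_iso B C h"
    and f: "f \<in> carrier (bigraph_Aut B)"
  shows "(\<lambda>y\<in>bverts C. h (f (inv_into (bverts B) h y))) \<in> carrier (bigraph_Aut C)"
proof -
  let ?k = "inv_into (bverts B) h"
  have "bigraph_iso B B f" using f by (simp add: bigraph_Aut_def)
  then have "bigraph_iso C C (h \<circ> (f \<circ> ?k))"
    using bip h by (meson bigraph_iso_trans bigraph_iso_sym)
  then show ?thesis
    by (simp add: bigraph_Aut_def bigraph_iso_iff bip Bij_def cong: bij_betw_cong)
qed

text \<open>Conjugation by \<open>h\<close> is a group isomorphism, with conjugation by the inverse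
  of \<open>h\<close> as its inverse.\<close>

lemma bigraph_Aut_cong:
  assumes bip: "bipartite_graph B" "bipartite_graph C" and h: "bigraph_iso B C h"
  shows "bigraph_Aut B \<cong> bigraph_Aut C"
proof -
  let ?k = "inv_into (bverts B) h"
  let ?F = "\<lambda>f. \<lambda>y\<in>bverts C. h (f (?k y))"
  let ?G = "\<lambda>g. \<lambda>x\<in>bverts B. ?k (g (h x))"
  have bij: "bij_betw h (bverts B) (bverts C)" using h by (simp add: bigraph_iso_def)
  have k: "?k y \<in> bverts B" "h (?k y) = y" if "y \<in> bverts C" for y
    using that bij by (auto simp: bij_betw_inv_into_right bij_betw_imp_surj_on inv_into_into)
  have hk: "h x \<in> bverts C" "?k (h x) = x" if "x \<in> bverts B" for x
    using that bij by (auto simp: bij_betw_inv_into_left bij_betwE)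
  have G: "?G g \<in> carrier (bigraph_Aut B)" if "g \<in> carrier (bigraph_Aut C)" for g
  proof -
    have "(\<lambda>x\<in>bverts B. ?k (g (inv_into (bverts C) ?k x))) = ?G g"
      by (rule restrict_ext) (simp add: inv_into_inv_into_eq[OF bij])
    then show ?thesis
      using bigraph_iso_conj[OF bip(2,1) bigraph_iso_sym[OF bip h] that] by simp
  qed
  note F = bigraph_iso_conj[OF bip h]
  have "bij_betw ?F (carrier (bigraph_Aut B)) (carrier (bigraph_Aut C))"
  proof (rule bij_betw_byWitness[where f' = ?G])
    show "\<forall>f\<in>carrier (bigraph_Aut B). ?G (?F f) = f"
    proof
      fix f assume f: "f \<in> carrier (bigraph_Aut B)"
      show "?G (?F f) = f"
        by (rule extensionalityI[OF restrict_extensional bigraph_Aut_extensional[OF f]])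
          (simp add: hk bigraph_Aut_closed[OF f])
    qed
    show "\<forall>g\<in>carrier (bigraph_Aut C). ?F (?G g) = g"
    proof
      fix g assume g: "g \<in> carrier (bigraph_Aut C)"
      show "?F (?G g) = g"
        by (rule extensionalityI[OF restrict_extensional bigraph_Aut_extensional[OF g]])
          (simp add: k bigraph_Aut_closed[OF g])
    qed
  qed (intro image_subsetI F G; assumption)+
  moreover have "?F \<in> hom (bigraph_Aut B) (bigraph_Aut C)"
  proof (rule homI)
    fix f g assume fg: "f \<in> carrier (bigraph_Aut B)" "g \<in> carrier (bigraph_Aut B)"
    have "?F (compose (bverts B) f g) = compose (bverts C) (?F f) (?F g)"
      by (simp add: compose_def fun_eq_iff k hk bigraph_Aut_closed[OF fg(2)])
    then show "?F (f \<otimes>\<^bsub>bigraph_Aut B\<^esub> g) = ?F f \<otimes>\<^bsub>bigraph_Aut C\<^esub> ?F g"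
      using fg F by (simp add: bigraph_Aut_mult)
  qed (rule F)
  ultimately show ?thesis unfolding is_iso_def iso_def by blast
qed

section \<open>The attachment sets and the coding graph\<close>

text \<open>
  The set \<open>D\<^sub>S\<close> contains exactly one of \<open>4n + 1\<close> and \<open>4n + 3\<close>, so it determines \<open>S\<close> and both it and
  its complement in the odd numbers are infinite.
\<close>

definition attached :: "nat set \<Rightarrow> nat \<Rightarrow> bool" where
  "attached S k \<longleftrightarrow> k mod 4 = (if k div 4 \<in> S then 1 else 3)"

lemma attached_odd: "attached S k \<Longrightarrow> odd k"
proof -
  assume "attached S k"
  then have "k mod 4 = 1 \<or> k mod 4 = 3" by (simp add: attached_def split: if_splits)
  then show "odd k" by presburger
qed

lemma attached_4 [simp]:
  "\<not> attached S (4 * n)" "attached S (4 * n + 1) \<longleftrightarrow> n \<in> S" "attached S (4 * n + 3) \<longleftrightarrow> n \<notin> S"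
proof -
  have "(4 * n + 1) div 4 = n" "(4 * n + 1) mod 4 = 1" "(4 * n + 3) div 4 = n" "(4 * n + 3) mod 4 = 3"
    by presburger+
  then show "\<not> attached S (4 * n)" "attached S (4 * n + 1) \<longleftrightarrow> n \<in> S" "attached S (4 * n + 3) \<longleftrightarrow> n \<notin> S"
    unfolding attached_def by simp_all
qed

lemma infinite_attached: "infinite {k. attached S k}"
  unfolding infinite_nat_iff_unbounded_le
proof
  fix m
  have "attached S (if m \<in> S then 4 * m + 1 else 4 * m + 3)"
    by (cases "m \<in> S") (simp_all only: attached_4 if_True if_False not_False_eq_True)
  then show "\<exists>n\<ge>m. n \<in> {k. attached S k}"
    by (intro exI[of _ "if m \<in> S then 4 * m + 1 else 4 * m + 3"]) simp
qed

text \<open>The indices \<open>4 * n + 1\<close> alone already reveal which \<open>n\<close> lie in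
  the parameter set.\<close>

lemma attached_inject:
  assumes "\<And>k. attached S k \<longleftrightarrow> attached T k" shows "S = T"
proof -
  have "n \<in> S \<longleftrightarrow> n \<in> T" for n
    using assms[of "4 * n + 1"] by (simp only: attached_4)
  then show ?thesis by blast
qed

text \<open>
  \<open>Inl n\<close> is the ray vertex \<open>r\<^sub>n\<close>, \<open>Inr {u}\<close> a vertex and \<open>Inr {u, v}\<close> an edge of \<open>\<Gamma>\<close>.
\<close>

definition cverts :: "'a ugraph \<Rightarrow> (nat + 'a set) set" where
  "cverts G = range Inl \<union> Inr ` ((\<lambda>u. {u}) ` verts G \<union> (\<lambda>(u, v). {u, v}) ` edges G)"

text \<open>Adjacency before complementation. Between code sets, strict inclusion is incidence of a
  vertex with an edge of \<Gamma>; the condition \<open>card s = 1\<close> selects the vertices of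
  \<Gamma>.\<close>

fun cadj :: "nat set \<Rightarrow> nat + 'a set \<Rightarrow> nat + 'a set \<Rightarrow> bool" where
  "cadj S (Inl m) (Inl n) \<longleftrightarrow> m = Suc n \<or> n = Suc m"
| "cadj S (Inl m) (Inr s) \<longleftrightarrow> attached S m \<and> card s = 1"
| "cadj S (Inr s) (Inl m) \<longleftrightarrow> attached S m \<and> card s = 1"
| "cadj S (Inr s) (Inr t) \<longleftrightarrow> s \<subset> t \<or> t \<subset> s"

text \<open>The bipartition: odd ray vertices go with the edges of \<Gamma>, even ones with its
  vertices. As attached indices are odd, the extra adjacencies respect it.\<close>

fun colour :: "nat + 'a set \<Rightarrow> bool" where
  "colour (Inl n) \<longleftrightarrow> odd n"
| "colour (Inr s) \<longleftrightarrow> card s = 2"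

definition code_bigraph :: "'a ugraph \<Rightarrow> nat set \<Rightarrow> (nat + 'a set) bigraph" where
  "code_bigraph G S = \<lparr>bverts = cverts G,
     bedges = {(x, y) \<in> cverts G \<times> cverts G. colour x \<noteq> colour y \<and> \<not> cadj S x y},
     same_part = {(x, y) \<in> cverts G \<times> cverts G. colour x = colour y}\<rparr>"

lemma cadj_sym: "cadj S x y \<longleftrightarrow> cadj S y x"
  by (cases x; cases y) auto

lemma cverts_cases:
  assumes G: "undirected_graph G" and x: "x \<in> cverts G"
  obtains (ray) n where "x = Inl n"
  | (vertex) u where "x = Inr {u}" "u \<in> verts G"
  | (edge) u v where "x = Inr {u, v}" "(u, v) \<in> edges G" "u \<in> verts G" "v \<in> verts G" "u \<noteq> v"
proof -
  have "u \<in> verts G \<and> v \<in> verts G \<and> u \<noteq> v" if "(u, v) \<in> edges G" for u v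
    using that G by (auto simp: undirected_graph_def irrefl_def)
  with x that show thesis unfolding cverts_def by fast
qed

lemma Inl_in_cverts [simp]: "Inl n \<in> cverts G"
  by (simp add: cverts_def)

lemma vertex_in_cverts: "Inr {u} \<in> cverts G \<longleftrightarrow> u \<in> verts G" if "undirected_graph G"
proof
  assume "Inr {u} \<in> cverts G"
  then show "u \<in> verts G" by (cases rule: cverts_cases[OF that]) auto
qed (auto simp: cverts_def)

lemma edge_in_cverts:
  assumes G: "undirected_graph G" and "u \<noteq> v"
  shows "Inr {u, v} \<in> cverts G \<longleftrightarrow> (u, v) \<in> edges G"
proof
  assume "Inr {u, v} \<in> cverts G"
  then show "(u, v) \<in> edges G" using \<open>u \<noteq> v\<close> G
    by (cases rule: cverts_cases[OF G]) (auto simp: doubleton_eq_iff undirected_graph_def dest: symD)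
next
  assume "(u, v) \<in> edges G"
  then have "{u, v} \<in> (\<lambda>(u, v). {u, v}) ` edges G" by (rule rev_image_eqI) simp
  then show "Inr {u, v} \<in> cverts G" unfolding cverts_def by (intro UnI2 imageI)
qed

text \<open>The colouring is proper, so complementing only across the two parts loses no information
  about \<open>cadj\<close>.\<close>

lemma cadj_colour:
  assumes G: "undirected_graph G" and "x \<in> cverts G" "y \<in> cverts G" "cadj S x y"
  shows "colour x \<noteq> colour y"
  using G assms(2)
proof (cases rule: cverts_cases)
  case x: ray
  show ?thesis using assms(3)
    by (cases rule: cverts_cases[OF G]) (use x assms(4) in \<open>auto dest: attached_odd\<close>)
next
  case x: (vertex u)
  show ?thesis using assms(3)
    by (cases rule: cverts_cases[OF G]) (use x assms(4) in \<open>auto dest: attached_odd\<close>)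
next
  case x: (edge u v)
  show ?thesis using assms(3)
    by (cases rule: cverts_cases[OF G]) (use x assms(4) in \<open>auto dest: attached_odd\<close>)
qed

lemma code_bipartite: "bipartite_graph (code_bigraph G S)"
proof -
  have "\<exists>V0 V1. V0 \<union> V1 = cverts G \<and> V0 \<inter> V1 = {} \<and>
     {(x, y) \<in> cverts G \<times> cverts G. colour x = colour y} = V0 \<times> V0 \<union> V1 \<times> V1"
    by (rule exI[of _ "{x \<in> cverts G. colour x}"], rule exI[of _ "{x \<in> cverts G. \<not> colour x}"]) auto
  then show ?thesis
    unfolding bipartite_graph_def code_bigraph_def irrefl_def sym_def using cadj_sym by auto
qed

section \<open>Strong algebraic closure\<close>

text \<open>Vertices of \<Gamma> meet the ray only at attached indices. Discarding these leaves at
  most the two neighbours along the ray.\<close>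

lemma finite_unattached_neighbours:
  "finite {n. \<not> attached S n \<and> cadj S x (Inl n)}"
proof (cases x)
  case (Inl m)
  then have "{n. \<not> attached S n \<and> cadj S x (Inl n)} \<subseteq> {m - 1, Suc m}" by auto
  then show ?thesis by (rule finite_subset) simp
next
  case (Inr s)
  then have "{n. \<not> attached S n \<and> cadj S x (Inl n)} = {}" by auto
  then show ?thesis by (simp only: finite.emptyI)
qed

text \<open>Infinitely many unattached ray vertices have the colour opposite to \<open>A\<close>,
  and each member of the finite set \<open>A\<close> is \<open>cadj\<close>-adjacent to only
  finitely many of them. The rest are common neighbours in the complement.\<close>

lemma code_strongly_algebraically_closed:
  "strongly_algebraically_closed (code_bigraph G S)"
  unfolding strongly_algebraically_closed_def
proof (intro allI impI, elim conjE)
  fix A assume A: "finite A" "A \<subseteq> bverts (code_bigraph G S)"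
    "\<forall>u\<in>A. \<forall>v\<in>A. (u, v) \<in> same_part (code_bigraph G S)"
  \<comment> \<open>For empty \<open>A\<close> any colour will do.\<close>
  obtain c where c: "\<And>a. a \<in> A \<Longrightarrow> colour a = c"
  proof (cases "A = {}")
    case False
    then obtain b where "b \<in> A" by blast
    then have "colour a = colour b" if "a \<in> A" for a
      using A(3)[rule_format, OF that \<open>b \<in> A\<close>] by (simp add: code_bigraph_def)
    then show ?thesis using that by blast
  qed (use that in simp)
  let ?N = "{n. \<not> attached S n \<and> odd n \<noteq> c}"
  have "infinite ?N" unfolding infinite_nat_iff_unbounded_le
  proof
    fix m
    show "\<exists>n\<ge>m. n \<in> ?N"
    proof (cases c)
      case True
      then show ?thesis by (intro exI[of _ "4 * m"]) simp
    next
      case False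
      \<comment> \<open>Of the two odd candidates \<open>4 * m + 1\<close> and
        \<open>4 * m + 3\<close>, this is the one that is not attached.\<close>
      define n where "n = (if m \<in> S then 4 * m + 3 else 4 * m + 1)"
      have "\<not> attached S n" unfolding n_def
        by (cases "m \<in> S") (simp_all only: attached_4 if_True if_False not_False_eq_True simp_thms)
      moreover have "m \<le> n" "odd n" by (auto simp: n_def)
      ultimately show ?thesis using False by blast
    qed
  qed
  moreover have "finite (\<Union>a\<in>A. {n. \<not> attached S n \<and> cadj S a (Inl n)})"
    using A(1) finite_unattached_neighbours by blast
  ultimately have "infinite (?N - (\<Union>a\<in>A. {n. \<not> attached S n \<and> cadj S a (Inl n)}))"
    by (simp add: Diff_infinite_finite)
  then have "infinite ((Inl :: nat \<Rightarrow> nat + 'a set) ` (?N - (\<Union>a\<in>A. {n. \<not> attached S n \<and> cadj S a (Inl n)})))"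
    by (simp add: finite_image_iff)
  then show "infinite {w \<in> bverts (code_bigraph G S). \<forall>a\<in>A. (a, w) \<in> bedges (code_bigraph G S)}"
  proof (rule infinite_super[rotated], intro subsetI)
    fix w :: "nat + 'a set"
    assume "w \<in> Inl ` (?N - (\<Union>a\<in>A. {n. \<not> attached S n \<and> cadj S a (Inl n)}))"
    then obtain n where "w = Inl n" "odd n \<noteq> c" "\<And>a. a \<in> A \<Longrightarrow> \<not> cadj S a w" by blast
    then show "w \<in> {w \<in> bverts (code_bigraph G S). \<forall>a\<in>A. (a, w) \<in> bedges (code_bigraph G S)}"
      using A(2) c by (auto simp: code_bigraph_def)
  qed
qed

section \<open>Rigidity of the ray and the action on the rest\<close>

text \<open>By \<open>cadj_colour\<close> the complement can be undone, so \<open>cadj\<close> may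
  replace \<open>bedges\<close>. Colours are only compared with each other, since a map may
  interchange the parts.\<close>

lemma code_iso_iff:
  assumes G: "undirected_graph G"
  shows "bigraph_iso (code_bigraph G S) (code_bigraph G T) f \<longleftrightarrow>
    bij_betw f (cverts G) (cverts G) \<and>
    (\<forall>x\<in>cverts G. \<forall>y\<in>cverts G. (cadj S x y \<longleftrightarrow> cadj T (f x) (f y)) \<and>
       (colour x = colour y \<longleftrightarrow> colour (f x) = colour (f y)))"
proof (cases "bij_betw f (cverts G) (cverts G)")
  case True
  let ?B = "code_bigraph G"
  have f: "f x \<in> cverts G" if "x \<in> cverts G" for x
    using True that by (rule bij_betw_apply)
  have "((x, y) \<in> bedges (?B S) \<longleftrightarrow> (f x, f y) \<in> bedges (?B T)) \<and>
        ((x, y) \<in> same_part (?B S) \<longleftrightarrow> (f x, f y) \<in> same_part (?B T)) \<longleftrightarrow>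
      (cadj S x y \<longleftrightarrow> cadj T (f x) (f y)) \<and> (colour x = colour y \<longleftrightarrow> colour (f x) = colour (f y))"
    if xy: "x \<in> cverts G" "y \<in> cverts G" for x y
    using xy f[OF xy(1)] f[OF xy(2)] cadj_colour[OF G xy, of S] cadj_colour[OF G f[OF xy(1)] f[OF xy(2)], of T]
    unfolding code_bigraph_def by auto
  moreover have "bverts (?B S) = cverts G" "bverts (?B T) = cverts G"
    by (simp_all add: code_bigraph_def)
  ultimately show ?thesis
    using True by (simp add: bigraph_iso_iff[OF code_bipartite code_bipartite])
qed (simp add: bigraph_iso_def code_bigraph_def)

definition cnb :: "'a ugraph \<Rightarrow> nat set \<Rightarrow> nat + 'a set \<Rightarrow> (nat + 'a set) set" where
  "cnb G S x = {y \<in> cverts G. cadj S x y}"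

lemma cnb_start: "cnb G S (Inl 0) = {Inl 1}"
proof -
  have "\<not> attached S 0" using attached_odd[of S 0] by auto
  then have "cadj S (Inl 0) y \<longleftrightarrow> y = Inl 1" for y :: "nat + 'a set"
    by (cases y) auto
  then show ?thesis unfolding cnb_def using Inl_in_cverts by blast
qed

lemma finite_cnb_even:
  assumes "even n" shows "finite (cnb G S (Inl n))"
proof (rule finite_subset)
  show "cnb G S (Inl n) \<subseteq> {Inl (n - 1), Inl (Suc n)}"
  proof
    fix y assume "y \<in> cnb G S (Inl n)"
    then have "cadj S (Inl n) y" by (simp add: cnb_def)
    then show "y \<in> {Inl (n - 1), Inl (Suc n)}"
      using attached_odd[of S n] assms by (cases y) auto
  qed
qed simp

lemma infinite_cnb_vertex: "infinite (cnb G S (Inr {u}))"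
proof (rule infinite_super)
  show "Inl ` {k. attached S k} \<subseteq> cnb G S (Inr {u})" by (auto simp: cnb_def)
  show "infinite (Inl ` {k. attached S k} :: (nat + 'a set) set)"
    using infinite_attached by (simp add: finite_image_iff)
qed

text \<open>Every other vertex has at least two neighbours: both ray neighbours, infinitely many
  attached ray vertices, or the two endpoints of an edge.\<close>

lemma cnb_singleton_imp_start:
  assumes G: "undirected_graph G" and x: "x \<in> cverts G" and y: "cnb G S x = {y}"
  shows "x = Inl 0"
  using G x
proof (cases rule: cverts_cases)
  case (ray n)
  show ?thesis
  proof (cases n)
    case (Suc m)
    then have "Inl m \<in> cnb G S x" "Inl (Suc (Suc m)) \<in> cnb G S x"
      using ray by (auto simp: cnb_def)
    then show ?thesis unfolding y by force
  qed (use ray in simp)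
next
  case (vertex u)
  then have "infinite {y}" using infinite_cnb_vertex[of G S u] by (simp only: y[symmetric] not_False_eq_True)
  then show ?thesis by simp
next
  case (edge u v)
  then have "Inr {u} \<in> cnb G S x" "Inr {v} \<in> cnb G S x"
    unfolding cnb_def by (auto simp: vertex_in_cverts[OF G])
  then show ?thesis using \<open>u \<noteq> v\<close> unfolding y by force
qed

text \<open>With separate parameters \<open>S\<close> and \<open>T\<close> the same facts serve both
  for telling the graphs apart and, when \<open>S = T\<close>, for computing automorphisms.\<close>

locale code_iso =
  fixes G :: "'a ugraph" and S T :: "nat set" and f :: "nat + 'a set \<Rightarrow> nat + 'a set"
  assumes G: "undirected_graph G"
    and bij: "bij_betw f (cverts G) (cverts G)"
    and adj: "\<And>x y. x \<in> cverts G \<Longrightarrow> y \<in> cverts G \<Longrightarrow> cadj S x y \<longleftrightarrow> cadj T (f x) (f y)"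
begin

lemma closed: "x \<in> cverts G \<Longrightarrow> f x \<in> cverts G"
  using bij by (rule bij_betw_apply)

lemma inject: "x \<in> cverts G \<Longrightarrow> y \<in> cverts G \<Longrightarrow> f x = f y \<longleftrightarrow> x = y"
  using bij by (auto simp: bij_betw_def inj_on_def)

lemma image_cnb:
  assumes "x \<in> cverts G" shows "f ` cnb G S x = cnb G T (f x)"
proof -
  have surj: "f ` cverts G = cverts G" using bij by (simp add: bij_betw_imp_surj_on)
  have "cnb G T (f x) = {z \<in> f ` cverts G. cadj T (f x) z}"
    by (simp only: surj cnb_def)
  also have "\<dots> = f ` {y \<in> cverts G. cadj T (f x) (f y)}" by blast
  also have "{y \<in> cverts G. cadj T (f x) (f y)} = cnb G S x"
    unfolding cnb_def by (rule Collect_cong) (use adj[OF assms] in blast)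
  finally show ?thesis by (rule sym)
qed

text \<open>Induction on pairs of consecutive ray vertices: the image of the next one is a neighbour
  of the last fixed one, differs from its predecessor, and cannot be a vertex of \<Gamma> for
  reasons of degree.\<close>

lemma ray_fixed: "f (Inl n) = Inl n \<and> f (Inl (Suc n)) = Inl (Suc n)"
proof (induction n)
  case 0
  \<comment> \<open>The image of a vertex with one neighbour has one neighbour, hence is the start
    of the ray; its only neighbour is then fixed too.\<close>
  have *: "f ` {Inl 1} = cnb G T (f (Inl 0))"
    using image_cnb[of "Inl 0"] by (simp only: cnb_start Inl_in_cverts)
  then have "cnb G T (f (Inl 0)) = {f (Inl 1)}" by simp
  then have "f (Inl 0) = Inl 0"
    by (rule cnb_singleton_imp_start[OF G closed[OF Inl_in_cverts]])
  with * show ?case by (simp add: cnb_start)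
next
  case (Suc n)
  let ?y = "f (Inl (Suc (Suc n)))"
  have y: "?y \<in> cverts G" by (rule closed) simp
  have yadj: "cadj T (Inl (Suc n)) ?y"
    using adj[of "Inl (Suc n)" "Inl (Suc (Suc n))"] Suc by simp
  have "?y \<noteq> Inl n"
    using inject[of "Inl (Suc (Suc n))" "Inl n"] Suc by simp
  have "?y = Inl (Suc (Suc n))"
    using G y
  proof (cases rule: cverts_cases)
    case (ray m)
    then show ?thesis using yadj \<open>?y \<noteq> Inl n\<close> by auto
  next
    case (vertex u)
    \<comment> \<open>A ray vertex adjacent to a vertex of \<Gamma> has odd index, so the next index
      is even and its degree finite, unlike that of \<open>Inr {u}\<close>.\<close>
    then have "odd (Suc n)" using yadj attached_odd[of T "Suc n"] by simp
    then have "finite (cnb G S (Inl (Suc (Suc n))))" by (intro finite_cnb_even) simp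
    then have "finite (cnb G T ?y)"
      by (simp flip: image_cnb)
    then show ?thesis using vertex infinite_cnb_vertex by metis
  next
    case (edge u v)
    then show ?thesis using yadj by auto
  qed
  then show ?case using Suc by simp
qed

lemma not_ray:
  assumes "Inr s \<in> cverts G" shows "f (Inr s) \<noteq> Inl n"
  using inject[OF assms Inl_in_cverts[of n]] ray_fixed[of n] by simp

text \<open>The image stays adjacent to a fixed attached ray vertex and lies off the ray; off the
  ray, only vertices of \<Gamma> have ray neighbours.\<close>

lemma vertex_image:
  assumes u: "u \<in> verts G"
  obtains a where "a \<in> verts G" "f (Inr {u}) = Inr {a}"
proof -
  have x: "Inr {u} \<in> cverts G" using u by (simp add: vertex_in_cverts[OF G])
  obtain k where k: "attached S k"
    using infinite_attached[of S] not_finite_existsD by blast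
  then have "cadj T (Inl k) (f (Inr {u}))"
    using adj[OF Inl_in_cverts[of k] x] ray_fixed[of k] by simp
  with G closed[OF x] show thesis
    by (cases rule: cverts_cases) (use that not_ray[OF x] in auto)
qed

text \<open>The image lies off the ray and is adjacent to the distinct singletons \<open>{a}\<close>
  and \<open>{b}\<close>, which forces it to be the two-element set containing both.\<close>

lemma edge_image:
  assumes uv: "(u, v) \<in> edges G" and a: "f (Inr {u}) = Inr {a}" and b: "f (Inr {v}) = Inr {b}"
  shows "f (Inr {u, v}) = Inr {a, b} \<and> (a, b) \<in> edges G"
proof -
  have "u \<in> verts G" "v \<in> verts G" "u \<noteq> v"
    using uv G by (auto simp: undirected_graph_def irrefl_def)
  then have x: "Inr {u} \<in> cverts G" "Inr {v} \<in> cverts G" "Inr {u, v} \<in> cverts G"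
    using uv by (auto simp: vertex_in_cverts[OF G] edge_in_cverts[OF G])
  have "a \<noteq> b" using inject[OF x(1,2)] a b \<open>u \<noteq> v\<close> by auto
  have "{u} \<subset> {u, v}" "{v} \<subset> {u, v}" using \<open>u \<noteq> v\<close> by auto
  then have adj': "cadj T (Inr {a}) (f (Inr {u, v}))" "cadj T (Inr {b}) (f (Inr {u, v}))"
    using adj[OF x(1,3)] adj[OF x(2,3)] a b by simp_all
  have "f (Inr {u, v}) = Inr {a, b}"
    using G closed[OF x(3)]
  proof (cases rule: cverts_cases)
    case (ray n)
    then show ?thesis using not_ray[OF x(3)] by simp
  next
    case (vertex w)
    then show ?thesis using adj' by auto
  next
    case (edge p q)
    then have "a \<in> {p, q}" "b \<in> {p, q}" using adj' by auto
    then have "{p, q} = {a, b}" using \<open>a \<noteq> b\<close> by auto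
    then show ?thesis using edge by simp
  qed
  moreover have "(a, b) \<in> edges G"
    using closed[OF x(3)] calculation edge_in_cverts[OF G \<open>a \<noteq> b\<close>] by simp
  ultimately show ?thesis by simp
qed

text \<open>Attachment of \<open>k\<close> is adjacency of a fixed ray vertex to some
  \<open>Inr {u}\<close>, whose image is again a vertex of \<Gamma>; such a \<open>u\<close> exists
  because \<Gamma> is non-empty.\<close>

lemma parameter_unique: "S = T"
proof (rule attached_inject)
  fix k
  obtain u where u: "u \<in> verts G" using G by (auto simp: undirected_graph_def)
  then obtain a where a: "f (Inr {u}) = Inr {a}" by (rule vertex_image)
  have "Inr {u} \<in> cverts G" using u by (simp add: vertex_in_cverts[OF G])
  from adj[OF Inl_in_cverts[of k] this] show "attached S k \<longleftrightarrow> attached T k"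
    using ray_fixed[of k] a by simp
qed

text \<open>Makes the image lemmas available for the inverse, which yields surjectivity on vertices
  and reflection of edges.\<close>

lemma code_iso_inverse: "code_iso G T S (inv_into (cverts G) f)"
proof
  fix x y assume xy: "x \<in> cverts G" "y \<in> cverts G"
  let ?g = "inv_into (cverts G) f"
  have "?g x \<in> cverts G" "?g y \<in> cverts G" "f (?g x) = x" "f (?g y) = y"
    using xy bij by (auto simp: bij_betw_inv_into_right bij_betw_imp_surj_on inv_into_into)
  then show "cadj T x y \<longleftrightarrow> cadj S (?g x) (?g y)" using adj[of "?g x" "?g y"] by simp
qed (use G bij bij_betw_inv_into in auto)

end

section \<open>Automorphisms of \<Gamma> correspond to automorphisms of the coding graph\<close>

definition lift_perm :: "'a ugraph \<Rightarrow> ('a \<Rightarrow> 'a) \<Rightarrow> nat + 'a set \<Rightarrow> nat + 'a set" where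
  "lift_perm G p = (\<lambda>x\<in>cverts G. map_sum id ((`) p) x)"

lemma lift_perm_simps:
  "lift_perm G p (Inl n) = Inl n"
  "Inr s \<in> cverts G \<Longrightarrow> lift_perm G p (Inr s) = Inr (p ` s)"
  by (simp_all add: lift_perm_def)

lemma cverts_Inr_subset:
  assumes G: "undirected_graph G" and "Inr s \<in> cverts G" shows "s \<subseteq> verts G"
  using assms by (cases rule: cverts_cases) auto

lemma lift_perm_closed:
  assumes G: "undirected_graph G" and p: "p \<in> carrier (graph_Aut G)" and x: "x \<in> cverts G"
  shows "lift_perm G p x \<in> cverts G"
  using G x
proof (cases rule: cverts_cases)
  case (ray n)
  then show ?thesis by (simp add: lift_perm_simps)
next
  case (vertex u)
  then show ?thesis
    using x by (simp add: lift_perm_simps vertex_in_cverts[OF G] graph_Aut_closed[OF p])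
next
  case (edge u v)
  then have e: "(p u, p v) \<in> edges G" using p by (simp add: graph_Aut_carrier[OF G])
  then have "p u \<noteq> p v" using G by (auto simp: undirected_graph_def irrefl_def)
  then have "Inr {p u, p v} \<in> cverts G" using e by (simp add: edge_in_cverts[OF G])
  then show ?thesis using x edge(1) by (simp add: lift_perm_simps)
qed

lemma lift_perm_compose:
  assumes G: "undirected_graph G"
    and p: "p \<in> carrier (graph_Aut G)" and q: "q \<in> carrier (graph_Aut G)"
  shows "lift_perm G (compose (verts G) p q) = compose (cverts G) (lift_perm G p) (lift_perm G q)"
proof (rule extensionalityI)
  show "lift_perm G (compose (verts G) p q) \<in> extensional (cverts G)"
    by (simp add: lift_perm_def)
  show "compose (cverts G) (lift_perm G p) (lift_perm G q) \<in> extensional (cverts G)"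
    by (rule compose_extensional)
  fix x assume x: "x \<in> cverts G"
  show "lift_perm G (compose (verts G) p q) x = compose (cverts G) (lift_perm G p) (lift_perm G q) x"
  proof (cases x)
    case (Inl n)
    then show ?thesis using x by (simp add: lift_perm_simps compose_eq)
  next
    case (Inr s)
    have "compose (verts G) p q ` s = p ` q ` s"
      using cverts_Inr_subset[OF G] x Inr by (auto simp: compose_def image_iff subset_iff)
    moreover have "Inr (q ` s) \<in> cverts G"
      using lift_perm_closed[OF G q x] x Inr by (simp add: lift_perm_simps)
    ultimately show ?thesis using x Inr by (simp add: lift_perm_simps compose_eq)
  qed
qed

lemma lift_perm_inj_on:
  assumes G: "undirected_graph G" and p: "p \<in> carrier (graph_Aut G)"
  shows "inj_on (lift_perm G p) (cverts G)"
proof (rule inj_onI)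
  fix x y assume xy: "x \<in> cverts G" "y \<in> cverts G" and eq: "lift_perm G p x = lift_perm G p y"
  have inj: "inj_on p (verts G)" using p by (simp add: graph_Aut_carrier[OF G] Bij_def bij_betw_def)
  show "x = y"
  proof (cases x)
    case (Inl n)
    then show ?thesis using xy eq by (cases y) (simp_all add: lift_perm_simps)
  next
    case (Inr s)
    then obtain t where t: "y = Inr t" using xy eq by (cases y) (simp_all add: lift_perm_simps)
    have "s \<subseteq> verts G" "t \<subseteq> verts G" using cverts_Inr_subset[OF G] xy Inr t by auto
    moreover have "p ` s = p ` t" using xy eq Inr t by (simp add: lift_perm_simps)
    ultimately have "s = t" using inj_on_image_eq_iff[OF inj] by blast
    then show ?thesis using Inr t by simp
  qed
qed

lemma lift_perm_surj:
  assumes G: "undirected_graph G" and p: "p \<in> carrier (graph_Aut G)" and y: "y \<in> cverts G"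
  shows "y \<in> lift_perm G p ` cverts G"
proof -
  have surj: "\<exists>u\<in>verts G. a = p u" if "a \<in> verts G" for a
    using p that by (auto simp: graph_Aut_carrier[OF G] Bij_def bij_betw_def)
  show ?thesis using G y
  proof (cases rule: cverts_cases)
    case (ray n)
    then show ?thesis by (intro image_eqI[of _ _ "Inl n"]) (simp_all add: lift_perm_simps)
  next
    case (vertex a)
    then obtain u where u: "u \<in> verts G" "a = p u" using surj by blast
    then have "Inr {u} \<in> cverts G" by (simp add: vertex_in_cverts[OF G])
    then show ?thesis using vertex u by (intro image_eqI[of _ _ "Inr {u}"]) (simp_all add: lift_perm_simps)
  next
    case (edge a b)
    then obtain u v where uv: "u \<in> verts G" "a = p u" "v \<in> verts G" "b = p v" using surj by blast
    then have "(u, v) \<in> edges G" "u \<noteq> v"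
      using edge p by (auto simp: graph_Aut_carrier[OF G])
    then have "Inr {u, v} \<in> cverts G" by (simp add: edge_in_cverts[OF G])
    then show ?thesis using edge uv
      by (intro image_eqI[of _ _ "Inr {u, v}"]) (simp_all add: lift_perm_simps)
  qed
qed

text \<open>Off the ray, \<open>cadj\<close> and \<open>colour\<close> depend only on cardinalities
  and strict inclusions, and taking images under the injective \<open>p\<close> preserves and
  reflects these.\<close>

lemma lift_perm_Aut:
  assumes G: "undirected_graph G" and p: "p \<in> carrier (graph_Aut G)"
  shows "lift_perm G p \<in> carrier (bigraph_Aut (code_bigraph G S))"
proof -
  have inj: "inj_on p (verts G)" using p by (simp add: graph_Aut_carrier[OF G] Bij_def bij_betw_def)
  have card: "card (p ` s) = card s" if "Inr s \<in> cverts G" for s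
    by (rule card_image[OF inj_on_subset[OF inj cverts_Inr_subset[OF G that]]])
  have sub: "p ` s \<subset> p ` t \<longleftrightarrow> s \<subset> t" if "Inr s \<in> cverts G" "Inr t \<in> cverts G" for s t
  proof -
    have "p ` a \<subseteq> p ` b \<longleftrightarrow> a \<subseteq> b" if "a \<subseteq> verts G" "b \<subseteq> verts G" for a b
      using that inj_on_image_mem_iff[OF inj _ that(2)] by (simp only: image_subset_iff) blast
    then show ?thesis
      using cverts_Inr_subset[OF G that(1)] cverts_Inr_subset[OF G that(2)]
      by (simp add: less_le_not_le)
  qed
  have bij: "bij_betw (lift_perm G p) (cverts G) (cverts G)"
    unfolding bij_betw_def
    using lift_perm_inj_on[OF G p] lift_perm_surj[OF G p] lift_perm_closed[OF G p] by blast
  have "colour (lift_perm G p x) \<longleftrightarrow> colour x" if "x \<in> cverts G" for x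
    using that by (cases x) (simp_all add: lift_perm_simps card)
  moreover have "cadj S x y \<longleftrightarrow> cadj S (lift_perm G p x) (lift_perm G p y)"
    if "x \<in> cverts G" "y \<in> cverts G" for x y
    using that by (cases x; cases y) (simp_all add: lift_perm_simps card sub)
  ultimately have "bigraph_iso (code_bigraph G S) (code_bigraph G S) (lift_perm G p)"
    unfolding code_iso_iff[OF G] using bij by simp
  moreover have "lift_perm G p \<in> Bij (cverts G)"
    using bij by (simp add: Bij_def lift_perm_def)
  ultimately show ?thesis by (simp add: bigraph_Aut_def code_bigraph_def)
qed

lemma code_isoI:
  assumes G: "undirected_graph G" and f: "bigraph_iso (code_bigraph G S) (code_bigraph G T) f"
  shows "code_iso G S T f"
  using f G unfolding code_iso_iff[OF G] by unfold_locales auto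

text \<open>Surjectivity of the lifting. The permutation is read off from the singletons; the ray is
  fixed, and images of edges are determined by those of their endpoints.\<close>

lemma code_Aut_lift:
  assumes G: "undirected_graph G" and f: "f \<in> carrier (bigraph_Aut (code_bigraph G S))"
  obtains p where "p \<in> carrier (graph_Aut G)" "lift_perm G p = f"
proof -
  interpret code_iso G S S f
    using f by (intro code_isoI[OF G]) (simp add: bigraph_Aut_def)
  let ?g = "inv_into (cverts G) f"
  interpret g: code_iso G S S ?g by (rule code_iso_inverse)
  \<comment> \<open>\<open>vertex_image\<close> supplies a choice, which is unique; the restriction
    makes \<open>p\<close> extensional.\<close>
  define p where "p = (\<lambda>u\<in>verts G. SOME a. f (Inr {u}) = Inr {a})"
  have p: "f (Inr {u}) = Inr {p u}" "p u \<in> verts G" if u: "u \<in> verts G" for u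
  proof -
    obtain a where a: "a \<in> verts G" "f (Inr {u}) = Inr {a}" using u by (rule vertex_image)
    then have "p u = a" using u by (simp add: p_def)
    then show "f (Inr {u}) = Inr {p u}" "p u \<in> verts G" using a by simp_all
  qed
  have g: "?g (Inr {p u}) = Inr {u}" if "u \<in> verts G" for u
    using that bij p(1)[OF that] bij_betw_inv_into_left[OF bij, of "Inr {u}"]
    by (simp add: vertex_in_cverts[OF G])
  have "inj_on p (verts G)"
    by (rule inj_onI) (metis g Inr_inject singleton_inject)
  moreover have "verts G \<subseteq> p ` verts G"
  proof
    fix b assume b: "b \<in> verts G"
    then obtain a where a: "a \<in> verts G" "?g (Inr {b}) = Inr {a}" by (rule g.vertex_image)
    then have "f (Inr {a}) = Inr {b}"
      using b bij_betw_inv_into_right[OF bij, of "Inr {b}"] by (simp add: vertex_in_cverts[OF G])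
    then have "b = p a" using p(1)[OF a(1)] by simp
    with a(1) show "b \<in> p ` verts G" by blast
  qed
  ultimately have "bij_betw p (verts G) (verts G)"
    using p(2) by (auto simp: bij_betw_def)
  moreover have "(u, v) \<in> edges G \<longleftrightarrow> (p u, p v) \<in> edges G"
    if "u \<in> verts G" "v \<in> verts G" for u v
    \<comment> \<open>\<open>edge_image\<close> for \<open>f\<close> gives one direction, for its
      inverse the other.\<close>
    using edge_image[OF _ p(1)[OF that(1)] p(1)[OF that(2)]]
      g.edge_image[OF _ g[OF that(1)] g[OF that(2)]] by blast
  ultimately have "p \<in> carrier (graph_Aut G)"
    by (simp add: graph_Aut_carrier[OF G] Bij_def p_def)
  moreover have "lift_perm G p = f"
  proof (rule extensionalityI)
    show "lift_perm G p \<in> extensional (cverts G)" by (simp add: lift_perm_def)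
    show "f \<in> extensional (cverts G)"
      using bigraph_Aut_extensional[OF f] by (simp add: code_bigraph_def)
    fix x assume x: "x \<in> cverts G"
    show "lift_perm G p x = f x" using G x
    proof (cases rule: cverts_cases)
      case (ray n)
      then show ?thesis using ray_fixed[of n] by (simp add: lift_perm_simps)
    next
      case (vertex u)
      then show ?thesis using x p(1) by (simp add: lift_perm_simps)
    next
      case (edge u v)
      then show ?thesis using x edge_image[OF edge(2) p(1)[OF edge(3)] p(1)[OF edge(4)]]
        by (simp add: lift_perm_simps)
    qed
  qed
  ultimately show thesis by (rule that)
qed

lemma graph_Aut_iso_code_Aut:
  assumes G: "undirected_graph G"
  shows "graph_Aut G \<cong> bigraph_Aut (code_bigraph G S)"
proof -
  let ?L = "lift_perm G" and ?A = "bigraph_Aut (code_bigraph G S)"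
  have "?L \<in> hom (graph_Aut G) ?A"
    by (rule homI) (simp_all add: lift_perm_Aut[OF G] graph_Aut_mult bigraph_Aut_mult
        lift_perm_compose[OF G], simp add: code_bigraph_def)
  moreover have "inj_on ?L (carrier (graph_Aut G))"
  proof (rule inj_onI)
    fix p q assume p: "p \<in> carrier (graph_Aut G)" and q: "q \<in> carrier (graph_Aut G)"
      and eq: "?L p = ?L q"
    have "p u = q u" if "u \<in> verts G" for u
    proof -
      have "Inr {u} \<in> cverts G" using that by (simp add: vertex_in_cverts[OF G])
      then show ?thesis using fun_cong[OF eq, of "Inr {u}"] by (simp add: lift_perm_simps)
    qed
    moreover have "p \<in> extensional (verts G)" "q \<in> extensional (verts G)"
      using p q by (simp_all add: graph_Aut_def Bij_def)
    ultimately show "p = q" by (meson extensionalityI)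
  qed
  moreover have "?L ` carrier (graph_Aut G) = carrier ?A"
  proof
    show "?L ` carrier (graph_Aut G) \<subseteq> carrier ?A" using lift_perm_Aut[OF G] by blast
    show "carrier ?A \<subseteq> ?L ` carrier (graph_Aut G)" using code_Aut_lift[OF G] by (metis imageI subsetI)
  qed
  ultimately show ?thesis unfolding is_iso_def iso_def bij_betw_def by blast
qed

section \<open>Transport to natural numbers as vertices\<close>

definition image_bigraph :: "('a \<Rightarrow> 'b) \<Rightarrow> 'a bigraph \<Rightarrow> 'b bigraph" where
  "image_bigraph h B = \<lparr>bverts = h ` bverts B, bedges = map_prod h h ` bedges B,
     same_part = map_prod h h ` same_part B\<rparr>"

lemma image_rel_iff:
  assumes "inj_on h V" "R \<subseteq> V \<times> V" "x \<in> V" "y \<in> V"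
  shows "(h x, h y) \<in> map_prod h h ` R \<longleftrightarrow> (x, y) \<in> R"
proof
  assume "(h x, h y) \<in> map_prod h h ` R"
  then obtain a b where ab: "(a, b) \<in> R" "h x = h a" "h y = h b" by auto
  then have "x = a" "y = b" using assms by (auto dest: inj_onD)
  then show "(x, y) \<in> R" using ab by simp
next
  assume "(x, y) \<in> R"
  then show "(h x, h y) \<in> map_prod h h ` R" by (rule rev_image_eqI) simp
qed

lemma image_bigraph_bipartite:
  assumes B: "bipartite_graph B" and inj: "inj_on h (bverts B)"
  shows "bipartite_graph (image_bigraph h B)"
proof -
  let ?V = "bverts B" and ?E = "bedges B" and ?P = "same_part B"
  obtain V0 V1 where V: "V0 \<union> V1 = ?V" "V0 \<inter> V1 = {}" "?P = V0 \<times> V0 \<union> V1 \<times> V1"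
    using B unfolding bipartite_graph_def by (elim conjE exE)
  have E: "?E \<subseteq> ?V \<times> ?V" "irrefl ?E" "sym ?E" "\<And>u v. (u, v) \<in> ?E \<Longrightarrow> (u, v) \<notin> ?P"
    using B by (simp_all add: bipartite_graph_def)
  have P: "?P \<subseteq> ?V \<times> ?V" unfolding V(3) V(1)[symmetric] by auto
  have "h ` V0 \<union> h ` V1 = h ` ?V" using V(1) by blast
  moreover have "h ` V0 \<inter> h ` V1 = {}"
    using inj_on_image_Int[OF inj, of V0 V1] V by auto
  moreover have "map_prod h h ` ?P = h ` V0 \<times> h ` V0 \<union> h ` V1 \<times> h ` V1"
    unfolding V(3) by (simp add: image_Un map_prod_surj_on)
  moreover have "map_prod h h ` ?E \<subseteq> h ` ?V \<times> h ` ?V" using E(1) by auto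
  moreover have "irrefl (map_prod h h ` ?E)"
  proof (rule irreflI, rule notI)
    fix a assume "(a, a) \<in> map_prod h h ` ?E"
    then obtain x y where xy: "(x, y) \<in> ?E" "h x = h y" by auto
    then have "x = y" using E(1) inj by (auto dest: inj_onD)
    then show False using xy(1) E(2) by (simp add: irrefl_def)
  qed
  moreover have "sym (map_prod h h ` ?E)"
  proof (rule symI)
    fix a b assume "(a, b) \<in> map_prod h h ` ?E"
    then obtain x y where "(x, y) \<in> ?E" "a = h x" "b = h y" by auto
    then show "(b, a) \<in> map_prod h h ` ?E" using symD[OF E(3)] by force
  qed
  moreover have "(a, b) \<notin> map_prod h h ` ?P" if "(a, b) \<in> map_prod h h ` ?E" for a b
  proof -
    obtain x y where xy: "(x, y) \<in> ?E" "a = h x" "b = h y" using \<open>(a, b) \<in> _\<close> by auto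
    then have "x \<in> ?V" "y \<in> ?V" using E(1) by auto
    then show ?thesis using image_rel_iff[OF inj P] E(4)[OF xy(1)] xy by simp
  qed
  ultimately show ?thesis
    unfolding bipartite_graph_def image_bigraph_def bigraph.simps
    by (intro conjI exI[of _ "h ` V0"] exI[of _ "h ` V1"] allI impI; assumption?; simp)
qed

lemma image_bigraph_iso:
  assumes B: "bipartite_graph B" and inj: "inj_on h (bverts B)"
  shows "bigraph_iso B (image_bigraph h B) h"
proof -
  have "bedges B \<subseteq> bverts B \<times> bverts B" "same_part B \<subseteq> bverts B \<times> bverts B"
    using B by (auto simp: bipartite_graph_def)
  then show ?thesis
    unfolding bigraph_iso_iff[OF B image_bigraph_bipartite[OF B inj]]
    using inj by (simp add: image_bigraph_def image_rel_iff bij_betw_def)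
qed

text \<open>The finite set is pulled back along \<open>h\<close>, and the infinite set of its common
  neighbours is pushed forward injectively.\<close>

lemma strongly_algebraically_closed_iso:
  assumes bip: "bipartite_graph B" "bipartite_graph C" and h: "bigraph_iso B C h"
    and B: "strongly_algebraically_closed B"
  shows "strongly_algebraically_closed C"
  unfolding strongly_algebraically_closed_def
proof (intro allI impI, elim conjE)
  fix A assume A: "finite A" "A \<subseteq> bverts C" "\<forall>u\<in>A. \<forall>v\<in>A. (u, v) \<in> same_part C"
  note h' = h[unfolded bigraph_iso_iff[OF bip]]
  have inj: "inj_on h (bverts B)" and surj: "h ` bverts B = bverts C"
    using h' by (auto simp: bij_betw_def)
  from A(2) obtain A' where A': "A' \<subseteq> bverts B" "A = h ` A'"
    unfolding surj[symmetric] by (auto simp: subset_image_iff)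
  then have "finite A'" using A(1) inj finite_imageD inj_on_subset by blast
  moreover have "(u, v) \<in> same_part B" if "u \<in> A'" "v \<in> A'" for u v
    using A(3) A' h' that by blast
  ultimately have "infinite {w \<in> bverts B. \<forall>a\<in>A'. (a, w) \<in> bedges B}"
    using B A'(1) unfolding strongly_algebraically_closed_def by blast
  moreover have "inj_on h {w \<in> bverts B. \<forall>a\<in>A'. (a, w) \<in> bedges B}"
    using inj by (rule inj_on_subset) blast
  ultimately have "infinite (h ` {w \<in> bverts B. \<forall>a\<in>A'. (a, w) \<in> bedges B})"
    using finite_imageD by blast
  then show "infinite {w \<in> bverts C. \<forall>a\<in>A. (a, w) \<in> bedges C}"
  proof (rule infinite_super[rotated], intro subsetI)
    fix z assume "z \<in> h ` {w \<in> bverts B. \<forall>a\<in>A'. (a, w) \<in> bedges B}"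
    then obtain w where w: "z = h w" "w \<in> bverts B" "\<And>a. a \<in> A' \<Longrightarrow> (a, w) \<in> bedges B" by blast
    have "(h a, h w) \<in> bedges C" if "a \<in> A'" for a
      using h' w(2) w(3)[OF that] A'(1) that by blast
    then show "z \<in> {w \<in> bverts C. \<forall>a\<in>A. (a, w) \<in> bedges C}"
      using w(1,2) surj A'(2) by blast
  qed
qed

theorem theorem5p4:
  fixes \<Gamma> :: "'a ugraph"
  assumes "undirected_graph \<Gamma>"
    and "countable (verts \<Gamma>)"
  shows "\<exists>\<B> :: nat bigraph set.
           \<B> \<approx> (UNIV :: nat set set) \<and>
           (\<forall>B\<in>\<B>. bipartite_graph B \<and> strongly_algebraically_closed B \<and>
                   bigraph_Aut B \<cong> graph_Aut \<Gamma>) \<and>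
           pairwise (\<lambda>B C. \<not> bigraph_isomorphic B C) \<B>"
proof -
  note G = assms(1)
  have "edges \<Gamma> \<subseteq> verts \<Gamma> \<times> verts \<Gamma>" using G by (simp add: undirected_graph_def)
  then have "countable (edges \<Gamma>)" using assms(2) countable_SIGMA countable_subset by metis
  then have "countable (cverts \<Gamma>)" using assms(2) by (simp add: cverts_def)
  \<comment> \<open>Countability of \<Gamma> enters here. One injection serves every
    \<open>S\<close>, because the vertex set \<open>cverts\<close> does not depend on
    \<open>S\<close>.\<close>
  then obtain h :: "nat + 'a set \<Rightarrow> nat" where "inj_on h (cverts \<Gamma>)"
    by (rule countableE)
  then have inj: "inj_on h (bverts (code_bigraph \<Gamma> S))" for S by (simp add: code_bigraph_def)
  define B where "B S = image_bigraph h (code_bigraph \<Gamma> S)" for S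
  have bip: "bipartite_graph (B S)" for S
    unfolding B_def by (rule image_bigraph_bipartite[OF code_bipartite inj])
  have iso: "bigraph_iso (code_bigraph \<Gamma> S) (B S) h" for S
    unfolding B_def by (rule image_bigraph_iso[OF code_bipartite inj])
  have sac: "strongly_algebraically_closed (B S)" for S
    by (rule strongly_algebraically_closed_iso[OF code_bipartite bip iso code_strongly_algebraically_closed])
  have "graph_Aut \<Gamma> \<cong> bigraph_Aut (B S)" for S
    by (rule iso_trans[OF graph_Aut_iso_code_Aut[OF G] bigraph_Aut_cong[OF code_bipartite bip iso]])
  then have aut: "bigraph_Aut (B S) \<cong> graph_Aut \<Gamma>" for S
    by (rule group.iso_sym[OF graph_Aut_group[OF G]])
  have noniso: "S = T" if ST: "bigraph_isomorphic (B S) (B T)" for S T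
  proof -
    obtain g where "bigraph_iso (B S) (B T) g" using ST unfolding bigraph_isomorphic_def by blast
    then have "bigraph_iso (code_bigraph \<Gamma> S) (B T) (g \<circ> h)"
      by (rule bigraph_iso_trans[OF code_bipartite bip bip iso])
    \<comment> \<open>Composing with the transports on both sides reduces the question to the coding
      graphs, where \<open>parameter_unique\<close> applies.\<close>
    then have "bigraph_iso (code_bigraph \<Gamma> S) (code_bigraph \<Gamma> T)
        (inv_into (bverts (code_bigraph \<Gamma> T)) h \<circ> (g \<circ> h))"
      by (rule bigraph_iso_trans[OF code_bipartite bip code_bipartite _
            bigraph_iso_sym[OF code_bipartite bip iso]])
    then show ?thesis by (rule code_iso.parameter_unique[OF code_isoI[OF G]])
  qed
  \<comment> \<open>Reflexivity turns \<open>B S = B T\<close> into an isomorphism, so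
    \<open>noniso\<close> also makes \<open>B\<close> injective; this gives the family its
    cardinality.\<close>
  have "bigraph_isomorphic (B S) (B S)" for S
    unfolding bigraph_isomorphic_def
    by (rule exI[of _ id]) (simp add: bigraph_iso_iff[OF bip bip])
  then have "inj B" using noniso by (metis injI)
  then have "range B \<approx> (UNIV :: nat set set)" by (rule inj_on_image_eqpoll_self)
  moreover have "pairwise (\<lambda>B C. \<not> bigraph_isomorphic B C) (range B)"
    using noniso unfolding pairwise_def by blast
  ultimately show ?thesis using bip sac aut by (intro exI[of _ "range B"]) blast
qed

end
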